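(* Let $(\mathcal{A},G,\alpha,\sigma)$ be a discrete twisted $C^*$-dynamical system and let $H$ and $K$ be two distinct subgroups of $G$. Then, in $\mathcal{A}\rtimes^{r}_{(\alpha,\sigma)}G$, $$d_{KK}\left(\mathcal{A}\rtimes^{r}_{(\alpha,\sigma)}H,\ \mathcal{A}\rtimes^{r}_{(\alpha,\sigma)}K\right)=1=d_{0}\left(\mathcal{A}\rtimes^{r}_{(\alpha,\sigma)}H,\ \mathcal{A}\rtimes^{r}_{(\alpha,\sigma)}K\right).$$
   Context: Distances. For a normed space $\mathcal{V}$, $B_1(\mathcal{V})$ is its closed unit ball and $d(v,S)=\inf\{\|v-s\| : s\in S\}$. For subspaces $\mathcal{Y},\mathcal{Z}$ of $\mathcal{V}$, the Kadison-Kastler distance is $$d_{KK}(\mathcal{Y},\mathcal{Z})=\max\left\{\sup_{y\in B_1(\mathcal{Y})} d(y,B_1(\mathcal{Z})),\ \sup_{z\in B_1(\mathcal{Z})} d(z,B_1(\mathcal{Y}))\right\}.$$ For $\gamma>0$ write $\mathcal{Y}\subseteq_{\gamma}\mathcal{Z}$ if for each $y\in B_1(\mathcal{Y})$ there is $z\in\mathcal{Z}$ with $\|y-z\|\le\gamma$; the Christensen distance is $d_0(\mathcal{Y},\mathcal{Z})=\inf\{\gamma>0 : \mathcal{Y}\subseteq_{\gamma}\mathcal{Z}\text{ and }\mathcal{Z}\subseteq_{\gamma}\mathcal{Y}\}$. Twisted systems. A discrete twisted $C^*$-dynamical system $(\mathcal{A},G,\alpha,\sigma)$ consists of a unital (nonzero)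 $C^*$-algebra $\mathcal{A}$, a discrete group $G$ with identity $e$, and maps $\alpha:G\to\mathrm{Aut}(\mathcal{A})$, $\sigma:G\times G\to\mathcal{U}(\mathcal{A})$ (unitary group of $\mathcal{A}$) such that for all $r,s,t\in G$ $$\alpha_s\circ\alpha_t=\mathrm{Ad}_{\sigma(s,t)}\circ\alpha_{st},\quad \sigma(r,s)\sigma(rs,t)=\alpha_r(\sigma(s,t))\sigma(r,st),\quad \sigma(s,e)=\sigma(e,s)=1,$$ where $\mathrm{Ad}_u(x)=uxu^*$. Reduced twisted crossed product. Let $\mathcal{A}$ be faithfully and non-degenerately represented on a Hilbert space $\mathcal{H}$. On $\ell^2(G,\mathcal{H})$ define, for $a\in\mathcal{A}$, $g,h\in G$, $\zeta\in\ell^2(G,\mathcal{H})$, $$(\pi_\alpha(a)\zeta)(h)=\alpha_{h^{-1}}(a)\zeta(h),\qquad (\lambda_\sigma^G(g)\zeta)(h)=\sigma(h^{-1},g)\zeta(g^{-1}h).$$ $\mathcal{A}\rtimes^{r}_{(\alpha,\sigma)}G$ is the $C^*$-algebra generated by $\pi_\alpha(\mathcal{A})$ and $\lambda_\sigma^G(G)$ in $B(\ell^2(G,\mathcal{H}))$; up to $*$-isomorphism it does not depend on the faithful representation. $\mathcal{A}$ is identified with $\pi_\alpha(\mathcal{A})$. For a subgroup $H\le G$, $\mathcal{A}\rtimes^{r}_{(\alpha,\sigma)}H$ (for the restricted system) is identified with the $C^*$-subalgebra of $\mathcal{A}\rtimes^{r}_{(\alpha,\sigma)}G$ that is the norm closure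 of $\{\sum_{g\in F}a_g\lambda_\sigma^G(g) : F\subseteq H\text{ finite},\ a_g\in\mathcal{A}\}$. *)

theory Defs
  imports "HOL-Analysis.Analysis" "HOL-Algebra.Group"
begin

section \<open>Complex normed spaces, Hilbert spaces and unital C*-algebras\<close>

class complex_normed_space = real_normed_vector +
  fixes scaleC :: "complex \<Rightarrow> 'a \<Rightarrow> 'a"  (infixr "*\<^sub>C" 75)
  assumes scaleC_add_right: "c *\<^sub>C (x + y) = c *\<^sub>C x + c *\<^sub>C y"
    and scaleC_add_left: "(c + d) *\<^sub>C x = c *\<^sub>C x + d *\<^sub>C x"
    and scaleC_scaleC: "c *\<^sub>C (d *\<^sub>C x) = (c * d) *\<^sub>C x"
    and scaleC_of_real: "complex_of_real r *\<^sub>C x = r *\<^sub>R x"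
    and norm_scaleC: "norm (c *\<^sub>C x) = cmod c * norm x"

interpretation complex_vector: vector_space "scaleC :: complex \<Rightarrow> 'a \<Rightarrow> 'a::complex_normed_space"
proof
  show "1 *\<^sub>C x = x" for x :: 'a
    using scaleC_of_real[of 1 x] by simp
qed (simp_all add: scaleC_add_right scaleC_add_left scaleC_scaleC)

text \<open>The inner product is linear in the first argument. Positivity and definiteness of
  the inner product follow from the formula for the norm.\<close>

class complex_hilbert_space = complex_normed_space + complete_space +
  fixes cinner :: "'a \<Rightarrow> 'a \<Rightarrow> complex"
  assumes cinner_add_left: "cinner (x + y) z = cinner x z + cinner y z"
    and cinner_scaleC_left: "cinner (c *\<^sub>C x) y = c * cinner x y"
    and cinner_commute: "cinner x y = cnj (cinner y x)"
    and norm_eq_sqrt_cinner: "norm x = sqrt (Re (cinner x x))"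

text \<open>The superclass \<^class>\<open>real_normed_algebra_1\<close> provides a unit with \<open>0 \<noteq> 1\<close> and
  \<open>norm 1 = 1\<close>; the latter holds in every nonzero unital C*-algebra.\<close>

class unital_cstar_algebra = complex_normed_space + real_normed_algebra_1 + complete_space +
  fixes adj :: "'a \<Rightarrow> 'a"
  assumes mult_scaleC_left: "(c *\<^sub>C x) * y = c *\<^sub>C (x * y)"
    and mult_scaleC_right: "x * (c *\<^sub>C y) = c *\<^sub>C (x * y)"
    and adj_add: "adj (x + y) = adj x + adj y"
    and adj_scaleC: "adj (c *\<^sub>C x) = cnj c *\<^sub>C adj x"
    and adj_mult: "adj (x * y) = adj y * adj x"
    and adj_adj: "adj (adj x) = x"
    and cstar_identity: "norm (adj x * x) = (norm x)\<^sup>2"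

definition unitary :: "'a::unital_cstar_algebra \<Rightarrow> bool" where
  "unitary u \<longleftrightarrow> adj u * u = 1 \<and> u * adj u = 1"

definition star_automorphism :: "('a::unital_cstar_algebra \<Rightarrow> 'a) \<Rightarrow> bool" where
  "star_automorphism \<phi> \<longleftrightarrow> bij \<phi>
     \<and> (\<forall>x y. \<phi> (x + y) = \<phi> x + \<phi> y) \<and> (\<forall>c x. \<phi> (c *\<^sub>C x) = c *\<^sub>C \<phi> x)
     \<and> (\<forall>x y. \<phi> (x * y) = \<phi> x * \<phi> y) \<and> (\<forall>x. \<phi> (adj x) = adj (\<phi> x))"

section \<open>Operators and representations\<close>

text \<open>\<open>B(H)\<close> consists of the elements of the library type of bounded real-linear maps that are
  complex-linear; its norm is the operator norm.\<close>

definition clinear_op :: "('h::complex_hilbert_space \<Rightarrow>\<^sub>L 'h) \<Rightarrow> bool" where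
  "clinear_op T \<longleftrightarrow> (\<forall>c x. blinfun_apply T (c *\<^sub>C x) = c *\<^sub>C blinfun_apply T x)"

definition is_adjoint ::
    "('h::complex_hilbert_space \<Rightarrow>\<^sub>L 'h) \<Rightarrow> ('h \<Rightarrow>\<^sub>L 'h) \<Rightarrow> bool" where
  "is_adjoint T S \<longleftrightarrow> (\<forall>x y. cinner (blinfun_apply T x) y = cinner x (blinfun_apply S y))"

definition star_representation ::
    "('a::unital_cstar_algebra \<Rightarrow> ('h::complex_hilbert_space \<Rightarrow>\<^sub>L 'h)) \<Rightarrow> bool" where
  "star_representation \<rho> \<longleftrightarrow> (\<forall>a. clinear_op (\<rho> a))
     \<and> (\<forall>a b. \<rho> (a + b) = \<rho> a + \<rho> b)
     \<and> (\<forall>c a x. blinfun_apply (\<rho> (c *\<^sub>C a)) x = c *\<^sub>C blinfun_apply (\<rho> a) x)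
     \<and> (\<forall>a b. \<rho> (a * b) = \<rho> a o\<^sub>L \<rho> b)
     \<and> (\<forall>a. is_adjoint (\<rho> a) (\<rho> (adj a)))"

definition faithful :: "('a::unital_cstar_algebra \<Rightarrow> ('h::complex_hilbert_space \<Rightarrow>\<^sub>L 'h)) \<Rightarrow> bool" where
  "faithful \<rho> \<longleftrightarrow> inj \<rho>"

definition nondegenerate :: "('a::unital_cstar_algebra \<Rightarrow> ('h::complex_hilbert_space \<Rightarrow>\<^sub>L 'h)) \<Rightarrow> bool" where
  "nondegenerate \<rho> \<longleftrightarrow>
     closure (complex_vector.span {blinfun_apply (\<rho> a) x | a x. True}) = UNIV"

text \<open>A C*-subalgebra of \<open>B(H)\<close>. There is no complex scalar multiplication on the type of
  bounded real-linear maps, hence the pointwise formulation of closure under it.\<close>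

definition cstar_subalgebra :: "('h::complex_hilbert_space \<Rightarrow>\<^sub>L 'h) set \<Rightarrow> bool" where
  "cstar_subalgebra B \<longleftrightarrow> closed B \<and> 0 \<in> B \<and> (\<forall>T\<in>B. clinear_op T)
     \<and> (\<forall>T\<in>B. \<forall>S\<in>B. T + S \<in> B) \<and> (\<forall>T\<in>B. \<forall>S\<in>B. T o\<^sub>L S \<in> B)
     \<and> (\<forall>c. \<forall>T\<in>B. \<forall>S. (\<forall>x. blinfun_apply S x = c *\<^sub>C blinfun_apply T x) \<longrightarrow> S \<in> B)
     \<and> (\<forall>T\<in>B. \<forall>S. is_adjoint T S \<longrightarrow> S \<in> B)"

definition cstar_generated ::
    "('h::complex_hilbert_space \<Rightarrow>\<^sub>L 'h) set \<Rightarrow> ('h \<Rightarrow>\<^sub>L 'h) set" where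
  "cstar_generated S = \<Inter>{B. cstar_subalgebra B \<and> S \<subseteq> B}"

section \<open>Square-summable families of vectors\<close>

definition square_summable :: "('g \<Rightarrow> 'h::complex_hilbert_space) \<Rightarrow> bool" where
  "square_summable f \<longleftrightarrow> (\<lambda>x. (norm (f x))\<^sup>2) summable_on UNIV"

lemma square_summable_zero: "square_summable (\<lambda>_. 0)"
  by (simp add: square_summable_def)

lemma square_summable_add:
  assumes "square_summable f" "square_summable g"
  shows "square_summable (\<lambda>x. f x + g x)"
proof -
  have *: "(norm (f x + g x))\<^sup>2 \<le> 2 * (norm (f x))\<^sup>2 + 2 * (norm (g x))\<^sup>2" for x
  proof -
    have "(norm (f x + g x))\<^sup>2 \<le> (norm (f x) + norm (g x))\<^sup>2"
      by (intro power_mono norm_triangle_ineq) auto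
    also have "\<dots> \<le> 2 * (norm (f x))\<^sup>2 + 2 * (norm (g x))\<^sup>2"
      using zero_le_power2[of "norm (f x) - norm (g x)"]
      by (simp add: power2_sum power2_diff)
    finally show ?thesis .
  qed
  have "(\<lambda>x. 2 * (norm (f x))\<^sup>2 + 2 * (norm (g x))\<^sup>2) summable_on UNIV"
    using assms unfolding square_summable_def
    by (intro summable_on_add summable_on_cmult_right) auto
  then show ?thesis
    unfolding square_summable_def
    by (rule summable_on_comparison_test) (use * in auto)
qed

lemma square_summable_scaleC:
  assumes "square_summable f"
  shows "square_summable (\<lambda>x. c *\<^sub>C f x)"
  using assms unfolding square_summable_def
  by (simp add: norm_scaleC power_mult_distrib summable_on_cmult_right)

lemma square_summable_scaleR:
  assumes "square_summable f"
  shows "square_summable (\<lambda>x. r *\<^sub>R f x)"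
  using square_summable_scaleC[OF assms, of "complex_of_real r"] by (simp add: scaleC_of_real)

lemma square_summable_uminus:
  assumes "square_summable f"
  shows "square_summable (\<lambda>x. - f x)"
  using square_summable_scaleR[OF assms, of "-1"] by simp

lemma square_summable_diff:
  assumes "square_summable f" "square_summable g"
  shows "square_summable (\<lambda>x. f x - g x)"
  using square_summable_add[OF assms(1) square_summable_uminus[OF assms(2)]] by simp

lemma cinner_add_right: "cinner x (y + z) = cinner x y + cinner x z"
  using cinner_commute[of x "y + z"] cinner_commute[of x y] cinner_commute[of x z]
  by (simp add: cinner_add_left)

lemma cinner_scaleC_right: "cinner x (c *\<^sub>C y) = cnj c * cinner x y"
  using cinner_commute[of x "c *\<^sub>C y"] cinner_commute[of x y]
  by (simp add: cinner_scaleC_left)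

lemma cinner_self: "cinner x x = complex_of_real ((norm x)\<^sup>2)"
proof -
  have "0 \<le> sqrt (Re (cinner x x))"
    using norm_eq_sqrt_cinner[of x] norm_ge_zero[of x] by simp
  then have "0 \<le> Re (cinner x x)" by simp
  then have "(norm x)\<^sup>2 = Re (cinner x x)" by (simp add: norm_eq_sqrt_cinner)
  moreover have "Im (cinner x x) = 0"
    using arg_cong[OF cinner_commute[of x x], of Im] by simp
  ultimately show ?thesis by (simp add: complex_eq_iff)
qed

lemma cinner_polarization:
  fixes x y :: "'a::complex_hilbert_space"
  defines "Q \<equiv> \<lambda>c. cinner (x + c *\<^sub>C y) (x + c *\<^sub>C y)"
  shows "cinner x y = (1/4) * (Q 1 + (-1) * Q (-1) + \<i> * Q \<i> + (-\<i>) * Q (-\<i>))"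
  unfolding Q_def
  by (simp only: cinner_add_left cinner_add_right cinner_scaleC_left cinner_scaleC_right)
     (simp add: algebra_simps)

lemma square_summable_cinner:
  assumes "square_summable f" "square_summable g"
  shows "(\<lambda>x. cinner (f x) (g x)) summable_on UNIV"
proof -
  have "(\<lambda>x. cinner (f x + c *\<^sub>C g x) (f x + c *\<^sub>C g x)) summable_on UNIV" for c
    using square_summable_add[OF assms(1) square_summable_scaleC[OF assms(2), of c]]
    unfolding cinner_self square_summable_def by (rule summable_on_of_real)
  then show ?thesis
    by (subst cinner_polarization) (intro summable_on_cmult_right summable_on_add)
qed

typedef (overloaded) ('g, 'h::complex_hilbert_space) ell2 =
    "{f :: 'g \<Rightarrow> 'h. square_summable f}"
  using square_summable_zero by blast

setup_lifting type_definition_ell2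

lemma square_summable_Rep_ell2: "square_summable (Rep_ell2 x)"
  using Rep_ell2 by blast

instantiation ell2 :: (type, complex_hilbert_space) real_normed_vector
begin

lift_definition zero_ell2 :: "('a, 'b) ell2" is "\<lambda>_. 0"
  by (rule square_summable_zero)
lift_definition plus_ell2 :: "('a, 'b) ell2 \<Rightarrow> ('a, 'b) ell2 \<Rightarrow> ('a, 'b) ell2"
  is "\<lambda>f g x. f x + g x" by (rule square_summable_add)
lift_definition minus_ell2 :: "('a, 'b) ell2 \<Rightarrow> ('a, 'b) ell2 \<Rightarrow> ('a, 'b) ell2"
  is "\<lambda>f g x. f x - g x" by (rule square_summable_diff)
lift_definition uminus_ell2 :: "('a, 'b) ell2 \<Rightarrow> ('a, 'b) ell2"
  is "\<lambda>f x. - f x" by (rule square_summable_uminus)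
lift_definition scaleR_ell2 :: "real \<Rightarrow> ('a, 'b) ell2 \<Rightarrow> ('a, 'b) ell2"
  is "\<lambda>r f x. r *\<^sub>R f x" by (rule square_summable_scaleR)
lift_definition norm_ell2 :: "('a, 'b) ell2 \<Rightarrow> real"
  is "\<lambda>f. sqrt (\<Sum>\<^sub>\<infinity>x. (norm (f x))\<^sup>2)" .

definition sgn_ell2 :: "('a, 'b) ell2 \<Rightarrow> ('a, 'b) ell2"
  where "sgn_ell2 x = inverse (norm x) *\<^sub>R x"
definition dist_ell2 :: "('a, 'b) ell2 \<Rightarrow> ('a, 'b) ell2 \<Rightarrow> real"
  where "dist_ell2 x y = norm (x - y)"
definition uniformity_ell2 :: "(('a, 'b) ell2 \<times> ('a, 'b) ell2) filter"
  where [code del]: "uniformity_ell2 = (INF e\<in>{0<..}. principal {(x, y). dist x y < e})"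
definition open_ell2 :: "('a, 'b) ell2 set \<Rightarrow> bool"
  where [code del]: "open_ell2 U \<longleftrightarrow> (\<forall>x\<in>U. \<forall>\<^sub>F (x', y) in uniformity. x' = x \<longrightarrow> y \<in> U)"

instance
proof
  fix x y z :: "('a, 'b) ell2" and r s :: real
  show "x + y + z = x + (y + z)" by transfer (simp add: add.assoc)
  show "x + y = y + x" by transfer (simp add: add.commute)
  show "0 + x = x" by transfer simp
  show "- x + x = 0" by transfer simp
  show "x - y = x + - y" by transfer simp
  show "r *\<^sub>R (x + y) = r *\<^sub>R x + r *\<^sub>R y" by transfer (simp add: scaleR_add_right)
  show "(r + s) *\<^sub>R x = r *\<^sub>R x + s *\<^sub>R x" by transfer (simp add: scaleR_add_left)
  show "r *\<^sub>R s *\<^sub>R x = (r * s) *\<^sub>R x" by transfer simp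
  show "1 *\<^sub>R x = x" by transfer simp
  show "dist x y = norm (x - y)" by (rule dist_ell2_def)
  show "sgn x = inverse (norm x) *\<^sub>R x" by (rule sgn_ell2_def)
  show "uniformity = (INF e\<in>{0<..}. principal {(x, y :: ('a, 'b) ell2). dist x y < e})"
    by (rule uniformity_ell2_def)
  show "open U \<longleftrightarrow> (\<forall>x\<in>U. \<forall>\<^sub>F (x', y) in uniformity. x' = x \<longrightarrow> y \<in> U)"
    for U :: "('a, 'b) ell2 set" by (rule open_ell2_def)
  show "norm x = 0 \<longleftrightarrow> x = 0"
  proof transfer
    fix f :: "'a \<Rightarrow> 'b" assume "square_summable f"
    then show "sqrt (\<Sum>\<^sub>\<infinity>x. (norm (f x))\<^sup>2) = 0 \<longleftrightarrow> f = (\<lambda>_. 0)"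
      using nonneg_infsum_le_0D[of "\<lambda>x. (norm (f x))\<^sup>2" UNIV]
      by (auto simp: square_summable_def)
  qed
  show "norm (r *\<^sub>R x) = \<bar>r\<bar> * norm x"
    by transfer (simp add: power_mult_distrib infsum_cmult_right' real_sqrt_mult)
  show "norm (x + y) \<le> norm x + norm y"
  proof transfer
    fix f g :: "'a \<Rightarrow> 'b" assume f: "square_summable f" and g: "square_summable g"
    let ?N = "\<lambda>f :: 'a \<Rightarrow> 'b. sqrt (\<Sum>\<^sub>\<infinity>x. (norm (f x))\<^sup>2)"
    have part: "L2_set (\<lambda>x. norm (h x)) F \<le> ?N h" if "square_summable h" "finite F"
      for h :: "'a \<Rightarrow> 'b" and F
      using that unfolding L2_set_def square_summable_def
      by (intro real_sqrt_le_mono finite_sum_le_infsum) auto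
    have nn: "0 \<le> ?N h" for h by (simp add: infsum_nonneg)
    have "(\<Sum>\<^sub>\<infinity>x. (norm (f x + g x))\<^sup>2) \<le> (?N f + ?N g)\<^sup>2"
    proof (rule infsum_le_finite_sums)
      show "(\<lambda>x. (norm (f x + g x))\<^sup>2) summable_on UNIV"
        using square_summable_add[OF f g] by (simp add: square_summable_def)
      fix F :: "'a set" assume F: "finite F"
      have "L2_set (\<lambda>x. norm (f x + g x)) F \<le> L2_set (\<lambda>x. norm (f x) + norm (g x)) F"
        by (intro L2_set_mono norm_triangle_ineq) auto
      also have "\<dots> \<le> L2_set (\<lambda>x. norm (f x)) F + L2_set (\<lambda>x. norm (g x)) F"
        by (rule L2_set_triangle_ineq)
      also have "\<dots> \<le> ?N f + ?N g"
        by (intro add_mono part f g F)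
      finally have le: "L2_set (\<lambda>x. norm (f x + g x)) F \<le> ?N f + ?N g" .
      have "(\<Sum>x\<in>F. (norm (f x + g x))\<^sup>2) = (L2_set (\<lambda>x. norm (f x + g x)) F)\<^sup>2"
        by (simp add: L2_set_def sum_nonneg)
      also have "\<dots> \<le> (?N f + ?N g)\<^sup>2"
        by (intro power_mono le L2_set_nonneg)
      finally show "(\<Sum>x\<in>F. (norm (f x + g x))\<^sup>2) \<le> (?N f + ?N g)\<^sup>2" .
    qed
    then show "?N (\<lambda>x. f x + g x) \<le> ?N f + ?N g"
      using nn by (intro real_le_lsqrt add_nonneg_nonneg) auto
  qed
qed

end

lemma norm_ell2_sq: "(norm x)\<^sup>2 = (\<Sum>\<^sub>\<infinity>h. (norm (Rep_ell2 x h))\<^sup>2)"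
  by (simp add: norm_ell2.rep_eq infsum_nonneg)

lemma sum_le_norm_ell2:
  assumes "finite F"
  shows "(\<Sum>h\<in>F. (norm (Rep_ell2 x h))\<^sup>2) \<le> (norm x)\<^sup>2"
  unfolding norm_ell2_sq using square_summable_Rep_ell2[of x]
  by (intro finite_sum_le_infsum assms) (auto simp: square_summable_def)

lemma norm_Rep_ell2_le: "norm (Rep_ell2 x h) \<le> norm x"
  using sum_le_norm_ell2[of "{h}" x] by simp

instantiation ell2 :: (type, complex_hilbert_space) complex_hilbert_space
begin

lift_definition scaleC_ell2 :: "complex \<Rightarrow> ('a, 'b) ell2 \<Rightarrow> ('a, 'b) ell2"
  is "\<lambda>c f x. c *\<^sub>C f x" by (rule square_summable_scaleC)
lift_definition cinner_ell2 :: "('a, 'b) ell2 \<Rightarrow> ('a, 'b) ell2 \<Rightarrow> complex"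
  is "\<lambda>f g. \<Sum>\<^sub>\<infinity>x. cinner (f x) (g x)" .

instance
proof
  fix x y z :: "('a, 'b) ell2" and c d :: complex and r :: real
  show "c *\<^sub>C (x + y) = c *\<^sub>C x + c *\<^sub>C y" by transfer (simp add: scaleC_add_right)
  show "(c + d) *\<^sub>C x = c *\<^sub>C x + d *\<^sub>C x" by transfer (simp add: scaleC_add_left)
  show "c *\<^sub>C d *\<^sub>C x = (c * d) *\<^sub>C x" by transfer (simp add: scaleC_scaleC)
  show "complex_of_real r *\<^sub>C x = r *\<^sub>R x" by transfer (simp add: scaleC_of_real)
  show "norm (c *\<^sub>C x) = cmod c * norm x"
    by transfer (simp add: norm_scaleC power_mult_distrib infsum_cmult_right' real_sqrt_mult)
  show "cinner (x + y) z = cinner x z + cinner y z"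
    by transfer (simp add: cinner_add_left infsum_add square_summable_cinner)
  show "cinner (c *\<^sub>C x) y = c * cinner x y"
    by transfer (simp add: cinner_scaleC_left infsum_cmult_right')
  show "cinner x y = cnj (cinner y x)"
    by transfer (subst infsum_cnj[symmetric], subst cinner_commute, rule refl)
  show "norm x = sqrt (Re (cinner x x))"
    by transfer
       (simp add: cinner_self square_summable_def summable_on_of_real
          del: of_real_power flip: infsum_Re)
next
  fix X :: "nat \<Rightarrow> ('a, 'b) ell2"
  assume X: "Cauchy X"
  have "Cauchy (\<lambda>n. Rep_ell2 (X n) h)" for h
  proof (rule metric_CauchyI)
    fix e :: real assume "e > 0"
    then obtain N where N: "\<And>m n. m \<ge> N \<Longrightarrow> n \<ge> N \<Longrightarrow> dist (X m) (X n) < e"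
      using metric_CauchyD[OF X] by blast
    have "dist (Rep_ell2 (X m) h) (Rep_ell2 (X n) h) \<le> dist (X m) (X n)" for m n
      using norm_Rep_ell2_le[of "X m - X n" h] by (simp add: dist_norm minus_ell2.rep_eq)
    with N show "\<exists>M. \<forall>m\<ge>M. \<forall>n\<ge>M. dist (Rep_ell2 (X m) h) (Rep_ell2 (X n) h) < e"
      by (meson order_le_less_trans)
  qed
  then have "\<exists>l. (\<lambda>n. Rep_ell2 (X n) h) \<longlonglongrightarrow> l" for h
    using Cauchy_convergent convergent_def by blast
  then obtain f where f: "\<And>h. (\<lambda>n. Rep_ell2 (X n) h) \<longlonglongrightarrow> f h"
    by metis
  have key: "\<exists>N. \<forall>n\<ge>N. \<forall>F. finite F \<longrightarrow> (\<Sum>h\<in>F. (norm (Rep_ell2 (X n) h - f h))\<^sup>2) \<le> e\<^sup>2"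
    if "e > 0" for e :: real
  proof -
    obtain N where N: "\<And>m n. m \<ge> N \<Longrightarrow> n \<ge> N \<Longrightarrow> dist (X m) (X n) < e"
      using metric_CauchyD[OF X \<open>e > 0\<close>] by blast
    have "(\<Sum>h\<in>F. (norm (Rep_ell2 (X n) h - f h))\<^sup>2) \<le> e\<^sup>2" if n: "n \<ge> N" and F: "finite F" for n F
    proof (rule LIMSEQ_le_const2)
      show "(\<lambda>m. \<Sum>h\<in>F. (norm (Rep_ell2 (X n) h - Rep_ell2 (X m) h))\<^sup>2)
              \<longlonglongrightarrow> (\<Sum>h\<in>F. (norm (Rep_ell2 (X n) h - f h))\<^sup>2)"
        by (intro tendsto_sum tendsto_power tendsto_norm tendsto_diff tendsto_const f)
      have "(\<Sum>h\<in>F. (norm (Rep_ell2 (X n) h - Rep_ell2 (X m) h))\<^sup>2) \<le> e\<^sup>2" if "m \<ge> N" for m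
      proof -
        have "(\<Sum>h\<in>F. (norm (Rep_ell2 (X n) h - Rep_ell2 (X m) h))\<^sup>2) \<le> (norm (X n - X m))\<^sup>2"
          using sum_le_norm_ell2[OF F, of "X n - X m"] by (simp add: minus_ell2.rep_eq)
        also have "\<dots> \<le> e\<^sup>2"
          using N[OF n that] by (intro power_mono) (auto simp: dist_norm)
        finally show ?thesis .
      qed
      then show "\<exists>N. \<forall>m\<ge>N. (\<Sum>h\<in>F. (norm (Rep_ell2 (X n) h - Rep_ell2 (X m) h))\<^sup>2) \<le> e\<^sup>2"
        by blast
    qed
    then show ?thesis by blast
  qed
  have diff: "square_summable (\<lambda>h. Rep_ell2 (X n) h - f h)"
    if "\<forall>F. finite F \<longrightarrow> (\<Sum>h\<in>F. (norm (Rep_ell2 (X n) h - f h))\<^sup>2) \<le> C" for n C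
    unfolding square_summable_def using that
    by (intro nonneg_bdd_above_summable_on bdd_aboveI[of _ C]) auto
  obtain n where "square_summable (\<lambda>h. Rep_ell2 (X n) h - f h)"
    using key[of 1] diff by (metis order_refl zero_less_one)
  from square_summable_diff[OF square_summable_Rep_ell2[of "X n"] this] have "square_summable f"
    by simp
  then obtain x where x: "Rep_ell2 x = f"
    using Abs_ell2_inverse by blast
  have "X \<longlonglongrightarrow> x"
  proof (rule metric_LIMSEQ_I)
    fix e :: real assume "e > 0"
    then obtain N where N: "\<And>n F. n \<ge> N \<Longrightarrow> finite F \<Longrightarrow>
        (\<Sum>h\<in>F. (norm (Rep_ell2 (X n) h - f h))\<^sup>2) \<le> (e/2)\<^sup>2"
      using key[of "e/2"] by auto
    have "dist (X n) x < e" if n: "n \<ge> N" for n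
    proof -
      have "(norm (X n - x))\<^sup>2 \<le> (e/2)\<^sup>2"
        unfolding norm_ell2_sq minus_ell2.rep_eq x
        by (rule infsum_le_finite_sums)
           (use diff[of n "(e/2)\<^sup>2"] N[OF n] in \<open>auto simp: square_summable_def\<close>)
      then have "norm (X n - x) \<le> e/2"
        using \<open>e > 0\<close> by (simp add: power2_le_iff_abs_le)
      then show ?thesis using \<open>e > 0\<close> by (simp add: dist_norm)
    qed
    then show "\<exists>N. \<forall>n\<ge>N. dist (X n) x < e" by blast
  qed
  then show "convergent X" by (rule convergentI)
qed

end

section \<open>Discrete twisted dynamical systems and reduced crossed products\<close>

definition twisted_system ::
    "('g, 'm) monoid_scheme \<Rightarrow> ('g \<Rightarrow> 'a::unital_cstar_algebra \<Rightarrow> 'a) \<Rightarrow> ('g \<Rightarrow> 'g \<Rightarrow> 'a) \<Rightarrow> bool"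
  where
  "twisted_system G \<alpha> \<sigma> \<longleftrightarrow> group G
     \<and> (\<forall>s\<in>carrier G. star_automorphism (\<alpha> s))
     \<and> (\<forall>s\<in>carrier G. \<forall>t\<in>carrier G. unitary (\<sigma> s t))
     \<and> (\<forall>s\<in>carrier G. \<forall>t\<in>carrier G. \<forall>x.
          \<alpha> s (\<alpha> t x) = \<sigma> s t * \<alpha> (s \<otimes>\<^bsub>G\<^esub> t) x * adj (\<sigma> s t))
     \<and> (\<forall>r\<in>carrier G. \<forall>s\<in>carrier G. \<forall>t\<in>carrier G.
          \<sigma> r s * \<sigma> (r \<otimes>\<^bsub>G\<^esub> s) t = \<alpha> r (\<sigma> s t) * \<sigma> r (s \<otimes>\<^bsub>G\<^esub> t))
     \<and> (\<forall>s\<in>carrier G. \<sigma> s \<one>\<^bsub>G\<^esub> = 1 \<and> \<sigma> \<one>\<^bsub>G\<^esub> s = 1)"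

text \<open>The space \<open>\<ell>\<^sup>2(G, H)\<close> is the closed subspace of \<^typ>\<open>('g, 'h) ell2\<close> of all families supported
  in \<^term>\<open>carrier G\<close> (the whole space if the carrier is the whole type). An operator on it is
  extended by \<open>0\<close> on the orthogonal complement; this extension is an isometric *-homomorphism of
  \<open>B(\<ell>\<^sup>2(G, H))\<close> into the operators on \<^typ>\<open>('g, 'h) ell2\<close>.

  In the next two definitions the families on the right-hand side are square-summable and depend
  boundedly and linearly on \<open>\<zeta>\<close> for every twisted system and every representation \<open>\<rho>\<close>, because
  *-homomorphisms from a C*-algebra into \<open>B(H)\<close> are contractive; so \<^term>\<open>Abs_ell2\<close> and
  \<^term>\<open>Blinfun\<close> are applied inside their domains.\<close>

definition pi_op ::
    "('g, 'm) monoid_scheme \<Rightarrow> ('g \<Rightarrow> 'a::unital_cstar_algebra \<Rightarrow> 'a) \<Rightarrow>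
     ('a \<Rightarrow> ('h::complex_hilbert_space \<Rightarrow>\<^sub>L 'h)) \<Rightarrow> 'a \<Rightarrow> (('g, 'h) ell2 \<Rightarrow>\<^sub>L ('g, 'h) ell2)" where
  "pi_op G \<alpha> \<rho> a = Blinfun (\<lambda>\<zeta>. Abs_ell2 (\<lambda>h.
     if h \<in> carrier G then blinfun_apply (\<rho> (\<alpha> (inv\<^bsub>G\<^esub> h) a)) (Rep_ell2 \<zeta> h) else 0))"

definition lambda_op ::
    "('g, 'm) monoid_scheme \<Rightarrow> ('g \<Rightarrow> 'g \<Rightarrow> 'a::unital_cstar_algebra) \<Rightarrow>
     ('a \<Rightarrow> ('h::complex_hilbert_space \<Rightarrow>\<^sub>L 'h)) \<Rightarrow> 'g \<Rightarrow> (('g, 'h) ell2 \<Rightarrow>\<^sub>L ('g, 'h) ell2)" where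
  "lambda_op G \<sigma> \<rho> g = Blinfun (\<lambda>\<zeta>. Abs_ell2 (\<lambda>h.
     if h \<in> carrier G
     then blinfun_apply (\<rho> (\<sigma> (inv\<^bsub>G\<^esub> h) g)) (Rep_ell2 \<zeta> (inv\<^bsub>G\<^esub> g \<otimes>\<^bsub>G\<^esub> h)) else 0))"

definition reduced_crossed_product ::
    "('g, 'm) monoid_scheme \<Rightarrow> ('g \<Rightarrow> 'a::unital_cstar_algebra \<Rightarrow> 'a) \<Rightarrow> ('g \<Rightarrow> 'g \<Rightarrow> 'a) \<Rightarrow>
     ('a \<Rightarrow> ('h::complex_hilbert_space \<Rightarrow>\<^sub>L 'h)) \<Rightarrow> (('g, 'h) ell2 \<Rightarrow>\<^sub>L ('g, 'h) ell2) set" where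
  "reduced_crossed_product G \<alpha> \<sigma> \<rho> =
     cstar_generated (range (pi_op G \<alpha> \<rho>) \<union> lambda_op G \<sigma> \<rho> ` carrier G)"

text \<open>The crossed product by a subgroup \<open>H\<close> of \<open>G\<close>, as a subalgebra of the one by \<open>G\<close>.\<close>

definition subgroup_crossed_product ::
    "('g, 'm) monoid_scheme \<Rightarrow> ('g \<Rightarrow> 'a::unital_cstar_algebra \<Rightarrow> 'a) \<Rightarrow> ('g \<Rightarrow> 'g \<Rightarrow> 'a) \<Rightarrow>
     ('a \<Rightarrow> ('h::complex_hilbert_space \<Rightarrow>\<^sub>L 'h)) \<Rightarrow> 'g set \<Rightarrow> (('g, 'h) ell2 \<Rightarrow>\<^sub>L ('g, 'h) ell2) set"
  where
  "subgroup_crossed_product G \<alpha> \<sigma> \<rho> H =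
     closure {\<Sum>g\<in>F. pi_op G \<alpha> \<rho> (a g) o\<^sub>L lambda_op G \<sigma> \<rho> g | F a. finite F \<and> F \<subseteq> H}"

lemma subgroup_crossed_product_subset:
  assumes "H \<subseteq> carrier G"
  shows "subgroup_crossed_product G \<alpha> \<sigma> \<rho> H \<subseteq> reduced_crossed_product G \<alpha> \<sigma> \<rho>"
  unfolding reduced_crossed_product_def cstar_generated_def
proof (rule Inter_greatest)
  fix B assume "B \<in> {B. cstar_subalgebra B
                       \<and> range (pi_op G \<alpha> \<rho>) \<union> lambda_op G \<sigma> \<rho> ` carrier G \<subseteq> B}"
  then have B: "cstar_subalgebra B" "\<And>a. pi_op G \<alpha> \<rho> a \<in> B"
      "\<And>g. g \<in> carrier G \<Longrightarrow> lambda_op G \<sigma> \<rho> g \<in> B"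
    by auto
  from B(1) have closed: "closed B" and zero: "0 \<in> B"
    and add: "\<And>S T. S \<in> B \<Longrightarrow> T \<in> B \<Longrightarrow> S + T \<in> B"
    and comp: "\<And>S T. S \<in> B \<Longrightarrow> T \<in> B \<Longrightarrow> S o\<^sub>L T \<in> B"
    unfolding cstar_subalgebra_def by blast+
  have "(\<Sum>g\<in>F. pi_op G \<alpha> \<rho> (a g) o\<^sub>L lambda_op G \<sigma> \<rho> g) \<in> B" if "finite F" "F \<subseteq> H" for F a
    using that
  proof (induction F rule: finite_induct)
    case empty
    show ?case by (simp add: zero)
  next
    case (insert g F)
    then have "pi_op G \<alpha> \<rho> (a g) o\<^sub>L lambda_op G \<sigma> \<rho> g \<in> B"
      using assms by (intro comp B(2,3)) auto
    with insert show ?case by (simp add: add)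
  qed
  then show "subgroup_crossed_product G \<alpha> \<sigma> \<rho> H \<subseteq> B"
    unfolding subgroup_crossed_product_def by (intro closure_minimal closed) auto
qed

section \<open>Distances between subspaces of a normed space\<close>

definition unit_ball_of :: "'v::real_normed_vector set \<Rightarrow> 'v set" where
  "unit_ball_of Y = {y \<in> Y. norm y \<le> 1}"

definition kadison_kastler_dist :: "'v::real_normed_vector set \<Rightarrow> 'v set \<Rightarrow> real" where
  "kadison_kastler_dist Y Z =
     max (SUP y\<in>unit_ball_of Y. infdist y (unit_ball_of Z))
         (SUP z\<in>unit_ball_of Z. infdist z (unit_ball_of Y))"

definition near_inclusion :: "real \<Rightarrow> 'v::real_normed_vector set \<Rightarrow> 'v set \<Rightarrow> bool" where
  "near_inclusion \<gamma> Y Z \<longleftrightarrow> (\<forall>y\<in>unit_ball_of Y. \<exists>z\<in>Z. norm (y - z) \<le> \<gamma>)"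

definition christensen_dist :: "'v::real_normed_vector set \<Rightarrow> 'v set \<Rightarrow> real" where
  "christensen_dist Y Z = Inf {\<gamma>. \<gamma> > 0 \<and> near_inclusion \<gamma> Y Z \<and> near_inclusion \<gamma> Z Y}"

end

theory Submission
  imports Defs
begin

text \<open>
  Both distances are at most 1 because \<open>0\<close> belongs to every subspace. For the lower bound, let
  \<open>g\<close> lie in \<open>H\<close> but not in \<open>K\<close> (or the other way round) and let \<open>\<delta>\<close> be a nonzero vector
  supported at the identity. A finite sum \<open>z = \<Sum>k\<in>F. a\<^sub>k \<lambda>(k)\<close> with \<open>F \<subseteq> K\<close> maps \<open>\<delta>\<close> to a vector
  supported in \<open>K\<close>, whereas \<open>\<lambda>(g) \<delta>\<close> is supported at \<open>g\<close> and as long as \<open>\<delta>\<close>. Hence the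
  \<open>g\<close>-coordinate alone shows \<open>\<parallel>(\<lambda>(g) - z) \<delta>\<parallel> \<ge> \<parallel>\<delta>\<parallel>\<close>, so the contraction \<open>\<lambda>(g)\<close> has distance at
  least 1 from all such \<open>z\<close> and from their limits (\<open>one_le_norm_lambda_diff\<close>).

  The coordinates of \<open>\<pi>(a) \<zeta>\<close> and \<open>\<lambda>(g) \<zeta>\<close> are given by the defining formulas only if these
  formulas describe bounded operators. This needs a bound on \<open>\<parallel>\<rho> (\<alpha>\<^sub>s a)\<parallel>\<close> that is uniform in \<open>s\<close>,
  which comes from the contractivity of *-representations (\<open>norm_star_representation_le\<close>), applied
  to the representations \<open>\<rho> \<circ> \<alpha>\<^sub>s\<close>.
\<close>

section \<open>Contractivity of *-representations\<close>

instance unital_cstar_algebra \<subseteq> banach ..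

lemma left_inverse_one_minus:
  fixes c :: "'a::{real_normed_algebra_1,banach}"
  assumes "norm c < 1"
  obtains d where "d * (1 - c) = 1"
proof -
  have s: "summable (\<lambda>n. c ^ n)"
    using assms by (rule complete_algebra_summable_geometric)
  have "(\<Sum>n. c ^ n) * c = (\<Sum>n. c ^ Suc n)"
    using suminf_mult2[OF s, of c] by (simp add: power_commutes)
  also have "\<dots> = (\<Sum>n. c ^ n) - 1"
    using suminf_split_head[OF s] by simp
  finally have "(\<Sum>n. c ^ n) * (1 - c) = 1"
    by (simp add: algebra_simps)
  then show thesis by (rule that)
qed

lemma norm_diff_sq_cinner:
  "(norm (x - y))\<^sup>2 = (norm x)\<^sup>2 - 2 * Re (cinner x y) + (norm y)\<^sup>2"
  for x y :: "'h::complex_hilbert_space"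
proof -
  have "cinner (x + (-1) *\<^sub>C y) (x + (-1) *\<^sub>C y)
      = cinner x x - (cinner x y + cnj (cinner x y)) + cinner y y"
    using cinner_commute[of y x]
    by (simp only: cinner_add_left cinner_add_right cinner_scaleC_left cinner_scaleC_right)
       (simp add: algebra_simps)
  moreover have "(-1) *\<^sub>C y = - y"
    using scaleC_of_real[of "-1" y] by simp
  ultimately have "complex_of_real ((norm (x - y))\<^sup>2)
      = complex_of_real ((norm x)\<^sup>2) - (cinner x y + cnj (cinner x y))
        + complex_of_real ((norm y)\<^sup>2)"
    by (simp add: cinner_self del: of_real_power)
  from arg_cong[OF this, of Re] show ?thesis
    by (simp del: of_real_power)
qed

text \<open>The triangle inequality, already part of the class, yields Cauchy--Schwarz after squaring.\<close>

lemma Re_cinner_le: "Re (cinner x y) \<le> norm x * norm y"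
  for x y :: "'h::complex_hilbert_space"
proof -
  have "(norm (x - (- y)))\<^sup>2 \<le> (norm x + norm y)\<^sup>2"
    using norm_triangle_ineq[of x y] by (intro power_mono) auto
  moreover have "cinner x (- y) = - cinner x y"
    using cinner_scaleC_right[of x "-1" y] scaleC_of_real[of "-1" y] by simp
  ultimately show ?thesis
    using norm_diff_sq_cinner[of x "- y"] by (simp add: power2_sum)
qed

lemma norm_adjoint_le:
  assumes "is_adjoint S R"
  shows "norm R \<le> norm S"
proof (rule norm_blinfun_bound)
  fix y
  have "(norm (R y))\<^sup>2 = Re (cinner (S (R y)) y)"
    using assms cinner_self[of "R y"] by (simp add: is_adjoint_def del: of_real_power)
  also have "\<dots> \<le> norm (S (R y)) * norm y" by (rule Re_cinner_le)
  also have "\<dots> \<le> (norm S * norm (R y)) * norm y"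
    by (intro mult_right_mono norm_blinfun) simp
  finally have "norm (R y) * norm (R y) \<le> norm (R y) * (norm S * norm y)"
    by (simp add: power2_eq_square mult_ac)
  then show "norm (R y) \<le> norm S * norm y"
    by (cases "norm (R y) = 0") (auto simp: mult_le_cancel_left)
qed simp

text \<open>Suppose \<open>M = \<parallel>\<rho> a\<parallel>\<^sup>2\<close> exceeds \<open>\<parallel>a\<parallel>\<^sup>2 = \<parallel>a\<^sup>* a\<parallel>\<close>. Then \<open>1 - a\<^sup>* a / M\<close> has a left inverse, hence so
  does \<open>1 - S\<^sup>* S / M\<close> for \<open>S = \<rho> a\<close>, so this operator is bounded below. But
  \<open>\<parallel>x - S\<^sup>* S x / M\<parallel>\<^sup>2 \<le> \<parallel>x\<parallel>\<^sup>2 - \<parallel>S x\<parallel>\<^sup>2 / M\<close> is arbitrarily small for suitable unit vectors \<open>x\<close>.\<close>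

lemma norm_star_representation_le:
  fixes \<rho> :: "'a::unital_cstar_algebra \<Rightarrow> ('h::complex_hilbert_space \<Rightarrow>\<^sub>L 'h)"
  assumes \<rho>: "star_representation \<rho>" and one: "\<rho> 1 = id_blinfun"
  shows "norm (\<rho> a) \<le> norm a"
proof (rule ccontr)
  assume "\<not> norm (\<rho> a) \<le> norm a"
  then have less: "norm a < norm (\<rho> a)" by simp
  define M where "M = (norm (\<rho> a))\<^sup>2"
  have M: "0 < M" "(norm a)\<^sup>2 < M"
    using less norm_ge_zero[of a] unfolding M_def
    by (auto intro: power_strict_mono simp del: norm_ge_zero)
  define c where "c = (1 / M) *\<^sub>R (adj a * a)"
  have "norm c < 1" using M by (simp add: c_def cstar_identity)
  then obtain d where d: "d * (1 - c) = 1" by (rule left_inverse_one_minus)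
  define D where "D = norm (\<rho> d)"
  have add: "\<rho> (x + y) = \<rho> x + \<rho> y" and mult: "\<rho> (x * y) = \<rho> x o\<^sub>L \<rho> y"
    and adjoint: "is_adjoint (\<rho> x) (\<rho> (adj x))" for x y
    using \<rho> by (auto simp: star_representation_def)
  have scale: "\<rho> (r *\<^sub>R x) v = r *\<^sub>R \<rho> x v" for r x v
    using \<rho> by (metis scaleC_of_real star_representation_def)
  have bound: "(norm (\<rho> a x))\<^sup>2 \<le> M * (D\<^sup>2 / (D\<^sup>2 + 1)) * (norm x)\<^sup>2" for x
  proof -
    define T where "T = \<rho> (adj a) (\<rho> a x)"
    have "\<rho> (1 - c) + \<rho> c = \<rho> 1"
      unfolding add[symmetric] by simp
    then have "\<rho> (1 - c) x + \<rho> c x = x"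
      by (metis one blinfun.add_left blinfun_apply_id_blinfun id_apply)
    moreover have "\<rho> c x = (1 / M) *\<^sub>R T"
      by (simp add: c_def scale mult T_def)
    ultimately have "\<rho> (1 - c) x = x - (1 / M) *\<^sub>R T" by (simp add: algebra_simps)
    moreover have "\<rho> d (\<rho> (1 - c) x) = x"
      using arg_cong[OF d, of "\<lambda>z. blinfun_apply (\<rho> z) x"] by (simp add: mult one)
    ultimately have "norm x \<le> D * norm (x - (1 / M) *\<^sub>R T)"
      unfolding D_def by (metis norm_blinfun)
    then have "(norm x)\<^sup>2 \<le> (D * norm (x - (1 / M) *\<^sub>R T))\<^sup>2"
      by (rule power_mono) simp
    then have 1: "(norm x)\<^sup>2 \<le> D\<^sup>2 * (norm (x - (1 / M) *\<^sub>R T))\<^sup>2"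
      by (simp add: power_mult_distrib)
    have "norm T \<le> norm (\<rho> a) * norm (\<rho> a x)"
      unfolding T_def using norm_blinfun[of "\<rho> (adj a)" "\<rho> a x"]
        mult_right_mono[OF norm_adjoint_le[OF adjoint[of a]] norm_ge_zero[of "\<rho> a x"]] by linarith
    then have "(norm T)\<^sup>2 \<le> M * (norm (\<rho> a x))\<^sup>2"
      using power_mono[OF _ norm_ge_zero, of T "norm (\<rho> a) * norm (\<rho> a x)" 2]
      by (simp add: M_def power_mult_distrib)
    then have "(norm T)\<^sup>2 / M\<^sup>2 \<le> M * (norm (\<rho> a x))\<^sup>2 / M\<^sup>2"
      by (simp add: divide_right_mono)
    then have 2: "(norm T)\<^sup>2 / M\<^sup>2 \<le> (norm (\<rho> a x))\<^sup>2 / M"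
      using M by (simp add: power2_eq_square)
    have "cinner x ((1 / M) *\<^sub>R T) = complex_of_real (1 / M) * cinner x T"
      by (subst scaleC_of_real[symmetric], subst cinner_scaleC_right) simp
    moreover have "cinner x T = complex_of_real ((norm (\<rho> a x))\<^sup>2)"
      using adjoint[of a] cinner_self[of "\<rho> a x"]
      by (simp add: T_def is_adjoint_def del: of_real_power)
    ultimately have "Re (cinner x ((1 / M) *\<^sub>R T)) = (norm (\<rho> a x))\<^sup>2 / M"
      by (simp del: of_real_power of_real_divide)
    then have "(norm (x - (1 / M) *\<^sub>R T))\<^sup>2
        = (norm x)\<^sup>2 - 2 * ((norm (\<rho> a x))\<^sup>2 / M) + (norm T)\<^sup>2 / M\<^sup>2"
      using norm_diff_sq_cinner[of x "(1 / M) *\<^sub>R T"]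
      by (simp add: power_divide power_mult_distrib)
    with 2 have "(norm (x - (1 / M) *\<^sub>R T))\<^sup>2 \<le> (norm x)\<^sup>2 - (norm (\<rho> a x))\<^sup>2 / M"
      by linarith
    then have "(norm x)\<^sup>2 \<le> D\<^sup>2 * ((norm x)\<^sup>2 - (norm (\<rho> a x))\<^sup>2 / M)"
      using 1 by (meson mult_left_mono order_trans zero_le_power2)
    moreover have "(norm (\<rho> a x))\<^sup>2 \<le> M * (norm x)\<^sup>2"
      using power_mono[OF norm_blinfun[of "\<rho> a" x], of 2]
      by (simp add: M_def power_mult_distrib)
    then have "(norm (\<rho> a x))\<^sup>2 / M \<le> (norm x)\<^sup>2"
      using M by (simp add: field_simps)
    ultimately have "(D\<^sup>2 + 1) * ((norm (\<rho> a x))\<^sup>2 / M) \<le> D\<^sup>2 * (norm x)\<^sup>2"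
      by (simp add: algebra_simps add_divide_distrib)
    moreover have "0 < D\<^sup>2 + 1" by (simp add: add_nonneg_pos)
    ultimately show ?thesis
      using M by (simp add: field_simps)
  qed
  define b where "b = sqrt (M * (D\<^sup>2 / (D\<^sup>2 + 1)))"
  have b: "0 \<le> b" "b\<^sup>2 = M * (D\<^sup>2 / (D\<^sup>2 + 1))"
    using M by (simp_all add: b_def)
  have "norm (\<rho> a x) \<le> b * norm x" for x
  proof (rule power2_le_imp_le)
    show "(norm (\<rho> a x))\<^sup>2 \<le> (b * norm x)\<^sup>2"
      using bound[of x] by (simp only: power_mult_distrib b(2))
  qed (simp add: b(1))
  with b(1) have "norm (\<rho> a) \<le> b"
    by (rule norm_blinfun_bound)
  then have "M \<le> b\<^sup>2"
    unfolding M_def by (intro power_mono) auto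
  also have "\<dots> = M * (D\<^sup>2 / (D\<^sup>2 + 1))"
    by (rule b(2))
  also have "\<dots> < M * 1"
    using M by (intro mult_strict_left_mono) (auto simp: divide_less_eq_1 add_nonneg_pos)
  finally show False by simp
qed

text \<open>\<open>\<rho> 1\<close> fixes the range of every \<open>\<rho> a\<close>, and its fixed vectors form a closed subspace.\<close>

lemma nondegenerate_imp_unital:
  assumes "star_representation \<rho>" "nondegenerate \<rho>"
  shows "\<rho> 1 = id_blinfun"
proof (rule blinfun_eqI)
  fix x
  have mult: "\<rho> (a * b) = \<rho> a o\<^sub>L \<rho> b" and lin: "\<rho> a (c *\<^sub>C x) = c *\<^sub>C \<rho> a x" for a b c x
    using assms(1) by (auto simp: star_representation_def clinear_op_def)
  let ?E = "{x. \<rho> 1 x = x}"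
  have "complex_vector.subspace ?E"
    by (auto simp: complex_vector.subspace_def blinfun.add_right blinfun.zero_right lin)
  moreover have "{blinfun_apply (\<rho> a) x | a x. True} \<subseteq> ?E"
    by (auto simp: blinfun_apply_blinfun_compose[symmetric] mult[symmetric]
        simp del: blinfun_apply_blinfun_compose)
  ultimately have "complex_vector.span {blinfun_apply (\<rho> a) x | a x. True} \<subseteq> ?E"
    by (intro complex_vector.span_minimal)
  moreover have "closed ?E"
    by (intro closed_Collect_eq continuous_intros)
  ultimately have "closure (complex_vector.span {blinfun_apply (\<rho> a) x | a x. True}) \<subseteq> ?E"
    by (rule closure_minimal)
  then show "\<rho> 1 x = id_blinfun x"
    using assms(2) by (auto simp: nondegenerate_def)
qed

lemma norm_unitary: "norm u = 1" if "unitary u"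
  using that cstar_identity[of u] norm_ge_zero[of u]
  by (simp add: unitary_def power2_eq_1_iff)

lemma norm_representation_unitary:
  assumes "star_representation \<rho>" "\<rho> 1 = id_blinfun" "unitary u"
  shows "norm (\<rho> u x) = norm x"
proof (rule antisym)
  have le: "norm (\<rho> w y) \<le> norm y" if "unitary w" for w y
    using norm_blinfun[of "\<rho> w" y] norm_unitary[OF that]
      mult_right_mono[OF norm_star_representation_le[OF assms(1,2), of w] norm_ge_zero[of y]]
    by simp
  show "norm (\<rho> u x) \<le> norm x" by (rule le[OF assms(3)])
  have "\<rho> (adj u) (\<rho> u x) = \<rho> (adj u * u) x"
    using assms(1) by (simp add: star_representation_def)
  also have "\<dots> = x" using assms(2,3) by (simp add: unitary_def)
  finally show "norm x \<le> norm (\<rho> u x)"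
    using le[of "adj u" "\<rho> u x"] assms(3) by (simp add: unitary_def adj_adj)
qed

lemma star_automorphism_one:
  assumes "star_automorphism \<phi>"
  shows "\<phi> 1 = 1"
proof -
  \<comment> \<open>\<open>\<phi> 1 = \<phi> 1 * \<phi> e = \<phi> (1 * e) = 1\<close> for a preimage \<open>e\<close> of \<open>1\<close>.\<close>
  obtain e where "\<phi> e = 1"
    using assms by (metis bij_pointE star_automorphism_def)
  with assms show ?thesis
    by (metis mult.right_neutral mult_1 star_automorphism_def)
qed

lemma norm_representation_automorphism_le:
  assumes "star_representation \<rho>" "\<rho> 1 = id_blinfun" "star_automorphism \<phi>"
  shows "norm (\<rho> (\<phi> a)) \<le> norm a"
proof -
  have "star_representation (\<lambda>x. \<rho> (\<phi> x))"
    using assms(1,3) by (simp add: star_representation_def star_automorphism_def)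
  from norm_star_representation_le[OF this] show ?thesis
    using assms(2) star_automorphism_one[OF assms(3)] by simp
qed

section \<open>Weighted composition operators\<close>

text \<open>The common form of the operators \<open>\<pi>(a)\<close>, where \<open>f\<close> is the identity, and \<open>\<lambda>(g)\<close>, where \<open>f\<close> is
  a translation.\<close>

definition weighted_composition ::
    "'g set \<Rightarrow> ('g \<Rightarrow> 'g) \<Rightarrow> ('g \<Rightarrow> ('h::complex_hilbert_space \<Rightarrow>\<^sub>L 'h)) \<Rightarrow>
     (('g, 'h) ell2 \<Rightarrow>\<^sub>L ('g, 'h) ell2)" where
  "weighted_composition S f T = Blinfun (\<lambda>\<zeta>. Abs_ell2 (\<lambda>h.
     if h \<in> S then blinfun_apply (T h) (Rep_ell2 \<zeta> (f h)) else 0))"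

lemma
  fixes T :: "'g \<Rightarrow> ('h::complex_hilbert_space \<Rightarrow>\<^sub>L 'h)"
  assumes inj: "inj_on f S" and T: "\<And>h. h \<in> S \<Longrightarrow> norm (T h) \<le> C" and C: "0 \<le> C"
  shows Rep_weighted_composition:
      "Rep_ell2 (weighted_composition S f T \<zeta>) h = (if h \<in> S then T h (Rep_ell2 \<zeta> (f h)) else 0)"
    and norm_weighted_composition_le: "norm (weighted_composition S f T) \<le> C"
proof -
  define w where "w \<zeta> h = (if h \<in> S then T h (Rep_ell2 \<zeta> (f h)) else 0)" for \<zeta> h
  define W where "W \<zeta> = Abs_ell2 (w \<zeta>)" for \<zeta>
  have part: "(\<Sum>h\<in>F. (norm (w \<zeta> h))\<^sup>2) \<le> (C * norm \<zeta>)\<^sup>2" if F: "finite F" for \<zeta> F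
  proof -
    have "(\<Sum>h\<in>F. (norm (w \<zeta> h))\<^sup>2) = (\<Sum>h\<in>F \<inter> S. (norm (w \<zeta> h))\<^sup>2)"
      using F by (intro sum.mono_neutral_right) (auto simp: w_def)
    also have "\<dots> \<le> (\<Sum>h\<in>F \<inter> S. C\<^sup>2 * (norm (Rep_ell2 \<zeta> (f h)))\<^sup>2)"
    proof (rule sum_mono)
      fix h assume h: "h \<in> F \<inter> S"
      have "norm (w \<zeta> h) \<le> norm (T h) * norm (Rep_ell2 \<zeta> (f h))"
        using h by (simp add: w_def norm_blinfun)
      also have "\<dots> \<le> C * norm (Rep_ell2 \<zeta> (f h))"
        using T h by (intro mult_right_mono) auto
      finally show "(norm (w \<zeta> h))\<^sup>2 \<le> C\<^sup>2 * (norm (Rep_ell2 \<zeta> (f h)))\<^sup>2"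
        unfolding power_mult_distrib[symmetric] by (rule power_mono) simp
    qed
    also have "\<dots> = C\<^sup>2 * (\<Sum>k\<in>f ` (F \<inter> S). (norm (Rep_ell2 \<zeta> k))\<^sup>2)"
      using inj by (simp add: sum.reindex inj_on_Int sum_distrib_left)
    also have "\<dots> \<le> C\<^sup>2 * (norm \<zeta>)\<^sup>2"
      using F by (intro mult_left_mono sum_le_norm_ell2) auto
    finally show ?thesis by (simp add: power_mult_distrib)
  qed
  have summable: "square_summable (w \<zeta>)" for \<zeta>
    unfolding square_summable_def using part[of _ \<zeta>]
    by (intro nonneg_bdd_above_summable_on bdd_aboveI[of _ "(C * norm \<zeta>)\<^sup>2"]) auto
  have Rep: "Rep_ell2 (W \<zeta>) = w \<zeta>" for \<zeta>
    using summable by (simp add: W_def Abs_ell2_inverse)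
  have norm: "norm (W \<zeta>) \<le> C * norm \<zeta>" for \<zeta>
  proof -
    have "(norm (W \<zeta>))\<^sup>2 \<le> (C * norm \<zeta>)\<^sup>2"
      unfolding norm_ell2_sq Rep using summable[of \<zeta>] part[of _ \<zeta>]
      by (intro infsum_le_finite_sums) (auto simp: square_summable_def)
    then show ?thesis using C by (simp add: power2_le_iff_abs_le)
  qed
  have "bounded_linear W"
  proof (rule bounded_linear_intro[where K = C])
    show "W (x + y) = W x + W y" for x y
      by (simp add: Rep_ell2_inject[symmetric] Rep plus_ell2.rep_eq w_def fun_eq_iff
          blinfun.add_right)
    show "W (r *\<^sub>R x) = r *\<^sub>R W x" for r x
      by (simp add: Rep_ell2_inject[symmetric] Rep scaleR_ell2.rep_eq w_def fun_eq_iff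
          blinfun.scaleR_right)
    show "norm (W x) \<le> norm x * C" for x
      using norm[of x] by (simp add: mult.commute)
  qed
  moreover have "weighted_composition S f T = Blinfun W"
    by (simp add: weighted_composition_def W_def[abs_def] w_def[abs_def])
  ultimately have apply_eq: "blinfun_apply (weighted_composition S f T) = W"
    by (simp add: bounded_linear_Blinfun_apply)
  show "Rep_ell2 (weighted_composition S f T \<zeta>) h = (if h \<in> S then T h (Rep_ell2 \<zeta> (f h)) else 0)"
    by (simp add: apply_eq Rep w_def)
  show "norm (weighted_composition S f T) \<le> C"
    using C norm by (intro norm_blinfun_bound) (auto simp: apply_eq)
qed

lemma ell2_point_mass:
  obtains \<zeta> :: "('g, 'h::complex_hilbert_space) ell2"
  where "\<And>h. Rep_ell2 \<zeta> h = (if h = k then x else 0)" "norm \<zeta> = norm x"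
proof -
  define f where "f h = (if h = k then x else 0)" for h
  have sum: "((\<lambda>h. (norm (f h))\<^sup>2) has_sum (norm x)\<^sup>2) UNIV"
    using has_sum_finite[of "{k}" "\<lambda>h. (norm (f h))\<^sup>2"]
    by (subst has_sum_cong_neutral[where T = "{k}" and g = "\<lambda>h. (norm (f h))\<^sup>2"])
       (auto simp: f_def)
  then have "square_summable f"
    by (auto simp: square_summable_def summable_on_def)
  then have Rep: "Rep_ell2 (Abs_ell2 f) = f" by (simp add: Abs_ell2_inverse)
  have "(norm (Abs_ell2 f))\<^sup>2 = (norm x)\<^sup>2"
    unfolding norm_ell2_sq Rep using sum by (rule infsumI)
  then show thesis
    using that[of "Abs_ell2 f"] by (simp add: Rep f_def)
qed

section \<open>Distance of a translation from the crossed product by a subgroup\<close>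

context
  fixes G :: "('g, 'm) monoid_scheme"
    and \<alpha> :: "'g \<Rightarrow> 'a::unital_cstar_algebra \<Rightarrow> 'a"
    and \<sigma> :: "'g \<Rightarrow> 'g \<Rightarrow> 'a"
    and \<rho> :: "'a \<Rightarrow> ('h::complex_hilbert_space \<Rightarrow>\<^sub>L 'h)"
  assumes sys: "twisted_system G \<alpha> \<sigma>"
    and rep: "star_representation \<rho>" and unital: "\<rho> 1 = id_blinfun"
begin

interpretation group G
  using sys by (simp add: twisted_system_def)

lemma Rep_pi_op:
    "Rep_ell2 (pi_op G \<alpha> \<rho> a \<zeta>) h
      = (if h \<in> carrier G then \<rho> (\<alpha> (inv\<^bsub>G\<^esub> h) a) (Rep_ell2 \<zeta> h) else 0)"
  and norm_pi_op_le: "norm (pi_op G \<alpha> \<rho> a) \<le> norm a"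
proof -
  have eq: "pi_op G \<alpha> \<rho> a = weighted_composition (carrier G) (\<lambda>h. h) (\<lambda>h. \<rho> (\<alpha> (inv\<^bsub>G\<^esub> h) a))"
    by (simp add: pi_op_def weighted_composition_def)
  have "norm (\<rho> (\<alpha> (inv\<^bsub>G\<^esub> h) a)) \<le> norm a" if "h \<in> carrier G" for h
    using sys that
    by (intro norm_representation_automorphism_le rep unital) (simp add: twisted_system_def)
  note W = this inj_on_id2[of "carrier G"] norm_ge_zero[of a]
  show "Rep_ell2 (pi_op G \<alpha> \<rho> a \<zeta>) h
      = (if h \<in> carrier G then \<rho> (\<alpha> (inv\<^bsub>G\<^esub> h) a) (Rep_ell2 \<zeta> h) else 0)"
    unfolding eq by (subst Rep_weighted_composition[OF W(2,1,3)]) auto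
  show "norm (pi_op G \<alpha> \<rho> a) \<le> norm a"
    unfolding eq by (rule norm_weighted_composition_le[OF W(2,1,3)]) auto
qed

lemma
  assumes g: "g \<in> carrier G"
  shows Rep_lambda_op:
    "Rep_ell2 (lambda_op G \<sigma> \<rho> g \<zeta>) h
      = (if h \<in> carrier G then \<rho> (\<sigma> (inv\<^bsub>G\<^esub> h) g) (Rep_ell2 \<zeta> (inv\<^bsub>G\<^esub> g \<otimes>\<^bsub>G\<^esub> h)) else 0)"
  and norm_lambda_op_le: "norm (lambda_op G \<sigma> \<rho> g) \<le> 1"
proof -
  have eq: "lambda_op G \<sigma> \<rho> g
      = weighted_composition (carrier G) (\<lambda>h. inv\<^bsub>G\<^esub> g \<otimes>\<^bsub>G\<^esub> h) (\<lambda>h. \<rho> (\<sigma> (inv\<^bsub>G\<^esub> h) g))"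
    by (simp add: lambda_op_def weighted_composition_def)
  have le: "norm (\<rho> (\<sigma> (inv\<^bsub>G\<^esub> h) g)) \<le> 1" if "h \<in> carrier G" for h
  proof -
    have "unitary (\<sigma> (inv\<^bsub>G\<^esub> h) g)"
      using sys that g by (simp add: twisted_system_def)
    then show ?thesis
      using norm_star_representation_le[OF rep unital] by (metis norm_unitary)
  qed
  have inj: "inj_on (\<lambda>h. inv\<^bsub>G\<^esub> g \<otimes>\<^bsub>G\<^esub> h) (carrier G)"
    using g by (simp add: inj_on_def)
  show "Rep_ell2 (lambda_op G \<sigma> \<rho> g \<zeta>) h
      = (if h \<in> carrier G then \<rho> (\<sigma> (inv\<^bsub>G\<^esub> h) g) (Rep_ell2 \<zeta> (inv\<^bsub>G\<^esub> g \<otimes>\<^bsub>G\<^esub> h)) else 0)"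
    unfolding eq by (subst Rep_weighted_composition[OF inj le]) auto
  show "norm (lambda_op G \<sigma> \<rho> g) \<le> 1"
    unfolding eq by (rule norm_weighted_composition_le[OF inj le]) auto
qed

lemma pi_op_one_comp_lambda_op:
  assumes "g \<in> carrier G"
  shows "pi_op G \<alpha> \<rho> 1 o\<^sub>L lambda_op G \<sigma> \<rho> g = lambda_op G \<sigma> \<rho> g"
proof -
  have "\<alpha> (inv\<^bsub>G\<^esub> h) 1 = 1" if "h \<in> carrier G" for h
    using sys that by (intro star_automorphism_one) (simp add: twisted_system_def)
  then show ?thesis
    using assms
    by (auto intro!: blinfun_eqI
        simp: Rep_ell2_inject[symmetric] fun_eq_iff Rep_pi_op Rep_lambda_op unital)
qed

lemma lambda_op_in_subgroup_crossed_product: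
  assumes "g \<in> H" "H \<subseteq> carrier G"
  shows "lambda_op G \<sigma> \<rho> g \<in> subgroup_crossed_product G \<alpha> \<sigma> \<rho> H"
proof -
  have "lambda_op G \<sigma> \<rho> g = (\<Sum>k\<in>{g}. pi_op G \<alpha> \<rho> 1 o\<^sub>L lambda_op G \<sigma> \<rho> k)"
    using assms pi_op_one_comp_lambda_op[of g] by auto
  then have "lambda_op G \<sigma> \<rho> g
      \<in> {\<Sum>g\<in>F. pi_op G \<alpha> \<rho> (a g) o\<^sub>L lambda_op G \<sigma> \<rho> g | F a. finite F \<and> F \<subseteq> H}"
    using assms(1)
    by (intro CollectI exI[of _ "{g}"] exI[of _ "\<lambda>_. 1"]) simp
  then show ?thesis
    unfolding subgroup_crossed_product_def by (rule subsetD[OF closure_subset])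
qed

text \<open>Let \<open>\<zeta>\<close> be the family with value \<open>x\<close> at the identity and \<open>0\<close> elsewhere. For a finite sum \<open>z\<close>
  the family \<open>z \<zeta>\<close> is supported in \<open>K\<close>, so the \<open>g\<close>-coordinate of \<open>(\<lambda>(g) - z) \<zeta>\<close> is that of \<open>\<lambda>(g) \<zeta>\<close>,
  a vector of norm \<open>\<parallel>x\<parallel>\<close>. The bound passes to norm limits of such \<open>z\<close>.\<close>

lemma one_le_norm_lambda_diff:
  assumes g: "g \<in> carrier G" "g \<notin> K" and K: "K \<subseteq> carrier G"
    and z: "z \<in> subgroup_crossed_product G \<alpha> \<sigma> \<rho> K" and x: "x \<noteq> (0::'h)"
  shows "1 \<le> norm (lambda_op G \<sigma> \<rho> g - z)"
proof -
  have fin: "1 \<le> norm (lambda_op G \<sigma> \<rho> g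
      - (\<Sum>k\<in>F. pi_op G \<alpha> \<rho> (a k) o\<^sub>L lambda_op G \<sigma> \<rho> k))" (is "1 \<le> norm (_ - ?z)")
    if F: "F \<subseteq> K" for F a
  proof -
    obtain \<zeta> :: "('g, 'h) ell2"
      where \<zeta>: "\<And>h. Rep_ell2 \<zeta> h = (if h = \<one>\<^bsub>G\<^esub> then x else 0)" "norm \<zeta> = norm x"
      using ell2_point_mass[of "\<one>\<^bsub>G\<^esub>" x] by blast
    have "Rep_ell2 (pi_op G \<alpha> \<rho> (a k) (lambda_op G \<sigma> \<rho> k \<zeta>)) g = 0" if "k \<in> F" for k
    proof -
      have "k \<in> carrier G" "k \<noteq> g" using that F K g by auto
      then have "inv\<^bsub>G\<^esub> k \<otimes>\<^bsub>G\<^esub> g \<noteq> \<one>\<^bsub>G\<^esub>"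
        using g by (metis inv_equality inv_inv inv_closed)
      then show ?thesis
        using g \<open>k \<in> carrier G\<close> by (simp add: Rep_pi_op Rep_lambda_op \<zeta> blinfun.zero_right)
    qed
    moreover have "Rep_ell2 (\<Sum>k\<in>F. f k) g = (\<Sum>k\<in>F. Rep_ell2 (f k) g)"
      for f :: "'g \<Rightarrow> ('g, 'h) ell2"
      by (induction F rule: infinite_finite_induct)
         (auto simp: zero_ell2.rep_eq plus_ell2.rep_eq)
    ultimately have "Rep_ell2 (?z \<zeta>) g = 0"
      by (simp add: blinfun.sum_left)
    then have "Rep_ell2 ((lambda_op G \<sigma> \<rho> g - ?z) \<zeta>) g = \<rho> (\<sigma> (inv\<^bsub>G\<^esub> g) g) x"
      using g by (simp add: blinfun.diff_left minus_ell2.rep_eq Rep_lambda_op \<zeta>)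
    moreover have "norm (\<rho> (\<sigma> (inv\<^bsub>G\<^esub> g) g) x) = norm x"
      using sys g by (intro norm_representation_unitary rep unital) (simp add: twisted_system_def)
    ultimately have "norm x \<le> norm ((lambda_op G \<sigma> \<rho> g - ?z) \<zeta>)"
      using norm_Rep_ell2_le[of "(lambda_op G \<sigma> \<rho> g - ?z) \<zeta>" g] by simp
    also have "\<dots> \<le> norm (lambda_op G \<sigma> \<rho> g - ?z) * norm x"
      using norm_blinfun[of "lambda_op G \<sigma> \<rho> g - ?z" \<zeta>] \<zeta>(2) by simp
    finally show ?thesis using x by simp
  qed
  have "closed {z. 1 \<le> norm (lambda_op G \<sigma> \<rho> g - z)}"
    by (intro closed_Collect_le continuous_intros)
  then have "subgroup_crossed_product G \<alpha> \<sigma> \<rho> K \<subseteq> {z. 1 \<le> norm (lambda_op G \<sigma> \<rho> g - z)}"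
    unfolding subgroup_crossed_product_def using fin by (intro closure_minimal) auto
  with z show ?thesis by blast
qed

end

lemma zero_in_subgroup_crossed_product: "0 \<in> subgroup_crossed_product G \<alpha> \<sigma> \<rho> H"
proof -
  have "0 \<in> {\<Sum>g\<in>F. pi_op G \<alpha> \<rho> (a g) o\<^sub>L lambda_op G \<sigma> \<rho> g | F a. finite F \<and> F \<subseteq> H}"
    by (intro CollectI exI[of _ "{}"]) simp
  then show ?thesis
    unfolding subgroup_crossed_product_def by (rule subsetD[OF closure_subset])
qed

section \<open>Maximal distances\<close>

lemma kadison_kastler_dist_commute: "kadison_kastler_dist Y Z = kadison_kastler_dist Z Y"
  by (simp add: kadison_kastler_dist_def max.commute)

lemma christensen_dist_commute: "christensen_dist Y Z = christensen_dist Z Y"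
  unfolding christensen_dist_def by (rule arg_cong[of _ _ Inf]) auto

lemma infdist_unit_ball_le_1:
  assumes "0 \<in> Z" "y \<in> unit_ball_of Y"
  shows "infdist y (unit_ball_of Z) \<le> 1"
  using infdist_le[of 0 "unit_ball_of Z" y] assms by (simp add: unit_ball_of_def)

text \<open>A far vector on one side is enough: the other supremum cannot exceed 1, as \<open>0\<close> lies in both
  unit balls.\<close>

lemma kadison_kastler_dist_eq_1:
  assumes "0 \<in> Y" "0 \<in> Z" "u \<in> unit_ball_of Y" "\<And>z. z \<in> Z \<Longrightarrow> 1 \<le> norm (u - z)"
  shows "kadison_kastler_dist Y Z = 1"
proof -
  have zero: "0 \<in> unit_ball_of Y" "0 \<in> unit_ball_of Z"
    using assms(1,2) by (simp_all add: unit_ball_of_def)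
  have "1 \<le> infdist u (unit_ball_of Z)"
  proof -
    have "1 \<le> (INF z\<in>unit_ball_of Z. dist u z)"
      using zero(2) by (intro cINF_greatest) (auto simp: dist_norm unit_ball_of_def intro: assms(4))
    then show ?thesis using zero(2) by (auto simp: infdist_def)
  qed
  also have "\<dots> \<le> (SUP y\<in>unit_ball_of Y. infdist y (unit_ball_of Z))"
    using assms(3) infdist_unit_ball_le_1[OF assms(2)]
    by (intro cSUP_upper bdd_aboveI2[of _ _ 1])
  finally have "1 \<le> (SUP y\<in>unit_ball_of Y. infdist y (unit_ball_of Z))" .
  moreover have "(SUP y\<in>unit_ball_of Y. infdist y (unit_ball_of Z)) \<le> 1"
    using zero(1) infdist_unit_ball_le_1[OF assms(2)] by (intro cSUP_least) blast+
  moreover have "(SUP z\<in>unit_ball_of Z. infdist z (unit_ball_of Y)) \<le> 1"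
    using zero(2) infdist_unit_ball_le_1[OF assms(1)] by (intro cSUP_least) blast+
  ultimately show ?thesis by (simp add: kadison_kastler_dist_def)
qed

lemma christensen_dist_eq_1:
  assumes "0 \<in> Y" "0 \<in> Z" "u \<in> unit_ball_of Y" "\<And>z. z \<in> Z \<Longrightarrow> 1 \<le> norm (u - z)"
  shows "christensen_dist Y Z = 1"
  unfolding christensen_dist_def
proof (rule cInf_eq_minimum)
  show "1 \<in> {\<gamma>. \<gamma> > 0 \<and> near_inclusion \<gamma> Y Z \<and> near_inclusion \<gamma> Z Y}"
    using assms(1,2) by (simp add: near_inclusion_def unit_ball_of_def)
      (metis diff_zero)
  show "1 \<le> \<gamma>" if \<gamma>: "\<gamma> \<in> {\<gamma>. \<gamma> > 0 \<and> near_inclusion \<gamma> Y Z \<and> near_inclusion \<gamma> Z Y}" for \<gamma>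
  proof -
    obtain z where "z \<in> Z" "norm (u - z) \<le> \<gamma>"
      using \<gamma> assms(3) by (auto simp: near_inclusion_def)
    with assms(4)[of z] show ?thesis by linarith
  qed
qed

theorem corollary5p4:
  fixes G :: "('g, 'm) monoid_scheme"
    and \<alpha> :: "'g \<Rightarrow> 'a::unital_cstar_algebra \<Rightarrow> 'a"
    and \<sigma> :: "'g \<Rightarrow> 'g \<Rightarrow> 'a"
    and \<rho> :: "'a \<Rightarrow> ('h::complex_hilbert_space \<Rightarrow>\<^sub>L 'h)"
    and H K :: "'g set"
  assumes "twisted_system G \<alpha> \<sigma>"
    and "star_representation \<rho>" and "faithful \<rho>" and "nondegenerate \<rho>"
    and "subgroup H G" and "subgroup K G" and "H \<noteq> K"
  shows "kadison_kastler_dist (subgroup_crossed_product G \<alpha> \<sigma> \<rho> H)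
           (subgroup_crossed_product G \<alpha> \<sigma> \<rho> K) = 1
         \<and> christensen_dist (subgroup_crossed_product G \<alpha> \<sigma> \<rho> H)
           (subgroup_crossed_product G \<alpha> \<sigma> \<rho> K) = 1"
proof -
  let ?A = "subgroup_crossed_product G \<alpha> \<sigma> \<rho>"
  have unital: "\<rho> 1 = id_blinfun"
    using assms(2,4) by (rule nondegenerate_imp_unital)
  \<comment> \<open>Since \<open>1 \<noteq> 0\<close> in the algebra, faithfulness forces the Hilbert space to be nonzero.\<close>
  have "\<rho> 1 \<noteq> \<rho> 0"
    using assms(3) zero_neq_one unfolding faithful_def by (metis injD)
  then obtain x :: 'h where x: "x \<noteq> 0"
    using blinfun_eqI[of "\<rho> 1" "\<rho> 0"] by (metis blinfun.zero_right)
  have main: "kadison_kastler_dist (?A L) (?A L') = 1 \<and> christensen_dist (?A L) (?A L') = 1"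
    if L: "subgroup L G" "subgroup L' G" and g: "g \<in> L" "g \<notin> L'" for L L' g
  proof -
    have sub: "L \<subseteq> carrier G" "L' \<subseteq> carrier G"
      using L by (auto dest: subgroup.subset)
    have u: "lambda_op G \<sigma> \<rho> g \<in> unit_ball_of (?A L)"
      using lambda_op_in_subgroup_crossed_product[OF assms(1,2) unital g(1) sub(1)]
        norm_lambda_op_le[OF assms(1,2) unital, of g] g sub
      by (auto simp: unit_ball_of_def)
    have far: "1 \<le> norm (lambda_op G \<sigma> \<rho> g - z)" if "z \<in> ?A L'" for z
      using one_le_norm_lambda_diff[OF assms(1,2) unital _ g(2) sub(2) that x] g(1) sub(1) by blast
    show ?thesis
      using kadison_kastler_dist_eq_1[OF _ _ u far] christensen_dist_eq_1[OF _ _ u far]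
      by (simp add: zero_in_subgroup_crossed_product)
  qed
  from \<open>H \<noteq> K\<close> consider g where "g \<in> H" "g \<notin> K" | g where "g \<in> K" "g \<notin> H" by blast
  then show ?thesis
  proof cases
    case 1
    then show ?thesis using main assms(5,6) by blast
  next
    case 2
    then show ?thesis
      using main[OF assms(6,5)] by (simp add: kadison_kastler_dist_commute christensen_dist_commute)
  qed
qed

end
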